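(* Let $n\ge 3$ be an integer. Let $\mathcal{R}$ be a system of representatives (in integers coprime to $n$) of the group $(\mathbb{Z}/n\mathbb{Z})^{\times}/\{\pm 1\}$, ordered in some fixed way. For an integer $k$ with $\gcd(k,n)=1$, let $k^*$ denote an integer with $kk^*\equiv 1 \pmod n$, and put $s_k=2\sin(2\pi k/n)$. Define the sine matrix $S=(s_{jk^*})_{j,k\in\mathcal{R}}$. For integers $k$ with $\gcd(k,n)=1$ define $$\lambda(k)=\#\{q\in\mathbb{N} : q\ge 3,\ q\mid n,\ k\equiv 1 \pmod q\}$$ and $$\widehat{s}_k=\frac1n\sum_{l\in\mathcal{R}}\bigl(\lambda(lk)-\lambda(-lk)\bigr)s_l .$$ Then $S$ is invertible if and only if $n$ is square-free or $n=4$. In this case $$S^{-1}=(\widehat{s}_{jk^*})_{j,k\in\mathcal{R}}.$$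
   Context: The quantities $s_{jk^*}$ and $\widehat s_{jk^*}$ depend only on $jk^*$ modulo $n$, so they do not depend on the choice of the inverse $k^*$. *)

theory Defs
  imports
    "HOL-Analysis.Analysis"
    "HOL-Number_Theory.Cong"
    "HOL-Computational_Algebra.Squarefree"
    "Jordan_Normal_Form.Matrix"
begin

(* Two integers coprime to n lie in the same class of the unit group of Z/n modulo {1, -1}
   iff they are congruent modulo n up to sign. *)
definition unit_reps_mod_sign :: "nat \<Rightarrow> int set \<Rightarrow> bool" where
  "unit_reps_mod_sign n R \<longleftrightarrow>
     (\<forall>r\<in>R. coprime r (int n)) \<and>
     (\<forall>k. coprime k (int n) \<longrightarrow>
        (\<exists>!r. r \<in> R \<and> ([k = r] (mod int n) \<or> [k = - r] (mod int n))))"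

definition sine_coeff :: "nat \<Rightarrow> int \<Rightarrow> real" where
  "sine_coeff n k = 2 * sin (2 * pi * real_of_int k / real n)"

definition div_count :: "nat \<Rightarrow> int \<Rightarrow> nat" where
  "div_count n k = card {q :: nat. q \<ge> 3 \<and> q dvd n \<and> [k = 1] (mod int q)}"

definition sine_coeff_hat :: "nat \<Rightarrow> int set \<Rightarrow> int \<Rightarrow> real" where
  "sine_coeff_hat n R k =
     1 / real n *
     (\<Sum>l\<in>R. (real (div_count n (l * k)) - real (div_count n (- l * k))) * sine_coeff n l)"

(* Row index j and column index k run through rs in the given order; inv_mod k is an inverse of k
   modulo n. *)
definition quotient_matrix :: "(int \<Rightarrow> real) \<Rightarrow> (int \<Rightarrow> int) \<Rightarrow> int list \<Rightarrow> real mat" where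
  "quotient_matrix f inv_mod rs =
     mat (length rs) (length rs) (\<lambda>(i, j). f (rs ! i * inv_mod (rs ! j)))"

definition sine_matrix :: "nat \<Rightarrow> (int \<Rightarrow> int) \<Rightarrow> int list \<Rightarrow> real mat" where
  "sine_matrix n inv_mod rs = quotient_matrix (sine_coeff n) inv_mod rs"

definition sine_matrix_hat :: "nat \<Rightarrow> (int \<Rightarrow> int) \<Rightarrow> int list \<Rightarrow> real mat" where
  "sine_matrix_hat n inv_mod rs = quotient_matrix (sine_coeff_hat n (set rs)) inv_mod rs"

end

theory Submission
  imports Defs "HOL-Library.Real_Mod" "Jordan_Normal_Form.Determinant"
begin

text \<open>
  Write \<open>c\<close> for the Ramanujan sum of \<open>n\<close>. Folding sums over representatives up to sign into sums
  over all units and using \<open>4 sin a sin b = 2 (cos (a - b) - cos (a + b))\<close>, the \<open>(j, m)\<close> entry of the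
  product of the two matrices is \<open>(G(w) - G(-w)) / n\<close> with \<open>w = j m*\<close> and
  \<open>G(w) = \<Sum>t. \<lambda>(t) c(t - w)\<close>. The divisors 1 and 2 excluded from \<open>\<lambda>\<close> add the same amount to
  \<open>\<lambda>(t)\<close> for every unit \<open>t\<close>, and this cancels in the difference, so \<open>\<lambda>(t)\<close> may be replaced by the
  number of common divisors of \<open>n\<close> and \<open>t - 1\<close>. The resulting sum \<open>F(w)\<close> is multiplicative in \<open>n\<close> by
  the Chinese remainder theorem, and for a prime it equals \<open>n\<close> if \<open>w \<equiv> 1\<close> and 0 otherwise; hence the
  same holds for squarefree \<open>n\<close>. The case \<open>n = 4\<close> is a direct computation.

  If \<open>p\<^sup>2\<close> divides \<open>n\<close>, put \<open>m = n / p\<close>. Adding \<open>m\<close> permutes the units in a residue class modulo \<open>m\<close>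
  and multiplies \<open>exp(2 \<pi> i j k / n)\<close> by \<open>exp(2 \<pi> i j / p) \<noteq> 1\<close>, so the sum of these characters over
  the class vanishes. The indicator of the class of 1 minus that of the class of -1 is therefore
  in the kernel, and it is nonzero unless \<open>m \<le> 2\<close>, that is, \<open>n = 4\<close>.
\<close>

subsection \<open>Sums over the units modulo \<open>n\<close>\<close>

definition units_mod :: "nat \<Rightarrow> int set" where
  "units_mod n = {k \<in> {0..<int n}. coprime k (int n)}"

text \<open>Periodicity is required on units only, so that it covers \<open>f \<circ> inv_mod\<close>: the values of
  \<open>inv_mod\<close> at non-units are arbitrary.\<close>

definition unit_periodic :: "nat \<Rightarrow> (int \<Rightarrow> 'a) \<Rightarrow> bool" where
  "unit_periodic n f \<longleftrightarrow> (\<forall>k k'. coprime k (int n) \<longrightarrow> [k = k'] (mod int n) \<longrightarrow> f k = f k')"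

definition add_char :: "nat \<Rightarrow> int \<Rightarrow> complex" where
  "add_char n k = cis (2 * pi * real_of_int k / real n)"

definition ramanujan_sum :: "nat \<Rightarrow> int \<Rightarrow> complex" where
  "ramanujan_sum n x = (\<Sum>k\<in>units_mod n. add_char n (k * x))"

text \<open>The divisors 1 and 2, left out of \<open>div_count\<close>, are kept here: this makes
  the count multiplicative in \<open>n\<close>.\<close>

definition common_divisor_count :: "nat \<Rightarrow> int \<Rightarrow> nat" where
  "common_divisor_count n x = card {q :: nat. q dvd n \<and> int q dvd x}"

lemma finite_units_mod [simp]: "finite (units_mod n)"
  by (rule finite_subset[of _ "{0..<int n}"]) (auto simp: units_mod_def)

lemma units_mod_coprime: "k \<in> units_mod n \<Longrightarrow> coprime k (int n)"
  by (simp add: units_mod_def)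

lemma units_mod_1 [simp]: "units_mod (Suc 0) = {0}"
  by (auto simp: units_mod_def)

lemma mod_in_units_mod: "n > 0 \<Longrightarrow> coprime k (int n) \<Longrightarrow> k mod int n \<in> units_mod n"
  by (simp add: units_mod_def)

lemma units_mod_cong_imp_eq:
  "k \<in> units_mod n \<Longrightarrow> l \<in> units_mod n \<Longrightarrow> [k = l] (mod int n) \<Longrightarrow> k = l"
  by (simp add: units_mod_def cong_def)

lemma unit_periodicD:
  "unit_periodic n f \<Longrightarrow> coprime k (int n) \<Longrightarrow> [k = k'] (mod int n) \<Longrightarrow> f k = f k'"
  unfolding unit_periodic_def by blast

lemma unit_periodic_mod: "unit_periodic n f \<Longrightarrow> coprime k (int n) \<Longrightarrow> f (k mod int n) = f k"
  by (rule unit_periodicD[symmetric]) (auto simp: cong_def)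

text \<open>An injective self-map of a finite set is a bijection, so \<open>\<phi>\<close> followed
  by reduction modulo \<open>n\<close> permutes the units. As \<open>\<phi>\<close> need not be a
  homomorphism, the lemma serves shifts and inversion as well as multiplication by a unit.\<close>

lemma sum_units_mod_reindex:
  fixes f :: "int \<Rightarrow> 'a :: comm_monoid_add"
  assumes n: "n > 0" and f: "unit_periodic n f"
    and coprime: "\<And>k. k \<in> units_mod n \<Longrightarrow> coprime (\<phi> k) (int n)"
    and inj: "\<And>k l. \<lbrakk>k \<in> units_mod n; l \<in> units_mod n; [\<phi> k = \<phi> l] (mod int n)\<rbrakk> \<Longrightarrow> [k = l] (mod int n)"
  shows "(\<Sum>k\<in>units_mod n. f (\<phi> k)) = (\<Sum>k\<in>units_mod n. f k)"
proof -
  let ?\<psi> = "\<lambda>k. \<phi> k mod int n"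
  have i: "inj_on ?\<psi> (units_mod n)"
    by (rule inj_onI) (metis cong_def inj units_mod_cong_imp_eq)
  have "?\<psi> ` units_mod n \<subseteq> units_mod n"
    using coprime n by (auto intro: mod_in_units_mod)
  then have "?\<psi> ` units_mod n = units_mod n"
    using i by (intro endo_inj_surj) auto
  then have "bij_betw ?\<psi> (units_mod n) (units_mod n)"
    using i by (simp add: bij_betw_def)
  from sum.reindex_bij_betw[OF this, of f] show ?thesis
    by (simp add: unit_periodic_mod[OF f] coprime)
qed

lemma sum_units_mod_mult:
  fixes f :: "int \<Rightarrow> 'a :: comm_monoid_add"
  assumes "n > 0" "unit_periodic n f" "coprime a (int n)"
  shows "(\<Sum>k\<in>units_mod n. f (k * a)) = (\<Sum>k\<in>units_mod n. f k)"
  using assms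
  by (intro sum_units_mod_reindex) (auto dest: units_mod_coprime simp: cong_mult_rcancel)

lemma sum_units_mod_uminus:
  fixes f :: "int \<Rightarrow> 'a :: comm_monoid_add"
  assumes "n > 0" "unit_periodic n f"
  shows "(\<Sum>k\<in>units_mod n. f (- k)) = (\<Sum>k\<in>units_mod n. f k)"
  using sum_units_mod_mult[OF assms, of "-1"] by simp

text \<open>By the Chinese remainder theorem the residues modulo \<open>a\<close> and
  \<open>b\<close> identify the units modulo \<open>a * b\<close> with pairs of units, and the
  resulting double sum factors.\<close>

lemma sum_units_mod_crt:
  fixes f g :: "int \<Rightarrow> 'a :: comm_semiring_1"
  assumes pos: "a > 0" "b > 0" and ab: "coprime a b"
    and f: "unit_periodic a f" and g: "unit_periodic b g"
  shows "(\<Sum>k\<in>units_mod (a * b). f k * g k) = (\<Sum>k\<in>units_mod a. f k) * (\<Sum>k\<in>units_mod b. g k)"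
proof -
  let ?\<psi> = "\<lambda>k. (k mod int a, k mod int b)"
  have cab: "coprime (int a) (int b)" using ab by simp
  have "bij_betw ?\<psi> (units_mod (a * b)) (units_mod a \<times> units_mod b)"
  proof (rule bij_betw_imageI)
    show "inj_on ?\<psi> (units_mod (a * b))"
    proof (rule inj_onI)
      fix k l assume kl: "k \<in> units_mod (a * b)" "l \<in> units_mod (a * b)" and eq: "?\<psi> k = ?\<psi> l"
      have "[k = l] (mod int a * int b)"
        using eq cab by (intro coprime_cong_mult) (auto simp: cong_def)
      with kl show "k = l" by (intro units_mod_cong_imp_eq) auto
    qed
    show "?\<psi> ` units_mod (a * b) = units_mod a \<times> units_mod b"
    proof (intro Set.set_eqI iffI)
      fix y assume "y \<in> ?\<psi> ` units_mod (a * b)"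
      then show "y \<in> units_mod a \<times> units_mod b"
        using pos by (auto intro!: mod_in_units_mod dest!: units_mod_coprime)
    next
      fix y assume y: "y \<in> units_mod a \<times> units_mod b"
      obtain k l where kl: "y = (k, l)" "k \<in> units_mod a" "l \<in> units_mod b" using y by auto
      obtain x where x: "[x = k] (mod int a)" "[x = l] (mod int b)"
        using binary_chinese_remainder_int[OF cab, of k l] by blast
      have "coprime x (int a)" "coprime x (int b)"
        using kl x by (meson cong_imp_coprime cong_sym units_mod_coprime)+
      then have "x mod int (a * b) \<in> units_mod (a * b)"
        using pos by (intro mod_in_units_mod) auto
      moreover have "?\<psi> (x mod int (a * b)) = y"
        using kl x by (auto simp: cong_def units_mod_def mod_mod_cancel)
      ultimately show "y \<in> ?\<psi> ` units_mod (a * b)" by blast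
    qed
  qed
  from sum.reindex_bij_betw[OF this, of "\<lambda>(k, l). f k * g l"]
  have "(\<Sum>k\<in>units_mod (a * b). f (k mod int a) * g (k mod int b)) =
      (\<Sum>(k, l)\<in>units_mod a \<times> units_mod b. f k * g l)" by simp
  also have "(\<Sum>k\<in>units_mod (a * b). f (k mod int a) * g (k mod int b)) = (\<Sum>k\<in>units_mod (a * b). f k * g k)"
    by (intro sum.cong refl) (auto dest!: units_mod_coprime simp: unit_periodic_mod[OF f] unit_periodic_mod[OF g])
  finally show ?thesis by (simp add: sum_product sum.cartesian_product)
qed

subsection \<open>Ramanujan sums\<close>

lemma add_char_add: "add_char n (k + l) = add_char n k * add_char n l"
  by (simp add: add_char_def cis_mult add_divide_distrib distrib_left)

lemma add_char_mult_nat: "add_char n (k * int i) = add_char n k ^ i"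
  by (simp add: add_char_def Complex.DeMoivre mult_ac)

lemma add_char_eq_1_iff:
  assumes "n > 0"
  shows "add_char n k = 1 \<longleftrightarrow> int n dvd k"
proof -
  have "add_char n k = 1 \<longleftrightarrow> (\<exists>m::int. 2 * pi * real_of_int k / real n = 2 * pi * real_of_int m)"
    unfolding add_char_def cis_eq_1_iff by (simp add: mult_ac)
  also have "\<dots> \<longleftrightarrow> (\<exists>m::int. real_of_int k = real_of_int (int n * m))"
    using assms by (simp add: field_simps)
  also have "\<dots> \<longleftrightarrow> int n dvd k" by (simp only: of_int_eq_iff dvd_def)
  finally show ?thesis .
qed

lemma add_char_cong:
  assumes "n > 0" "[k = l] (mod int n)"
  shows "add_char n k = add_char n l"
proof -
  have "int n dvd k - l" using assms by (simp add: cong_iff_dvd_diff)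
  then have "add_char n (k - l) = 1" using assms add_char_eq_1_iff by blast
  then show ?thesis using add_char_add[of n "k - l" l] by simp
qed

lemma add_char_mult_cancel:
  "a > 0 \<Longrightarrow> add_char (a * b) (int a * k) = add_char b k"
  by (simp add: add_char_def mult_ac)

lemma unit_periodic_add_char: "n > 0 \<Longrightarrow> unit_periodic n (\<lambda>k. add_char n (k * x))"
  unfolding unit_periodic_def by (blast intro: add_char_cong cong_mult cong_refl)

lemma ramanujan_sum_cong:
  "n > 0 \<Longrightarrow> [x = y] (mod int n) \<Longrightarrow> ramanujan_sum n x = ramanujan_sum n y"
  unfolding ramanujan_sum_def by (intro sum.cong refl add_char_cong cong_mult cong_refl) auto

text \<open>Multiplication by the unit \<open>a\<close> permutes the units over which the sum
  runs.\<close>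

lemma ramanujan_sum_mult:
  assumes "n > 0" "coprime a (int n)"
  shows "ramanujan_sum n (a * x) = ramanujan_sum n x"
  using sum_units_mod_mult[OF assms(1) unit_periodic_add_char[OF assms(1), of x] assms(2)]
  unfolding ramanujan_sum_def by (simp add: mult_ac)

lemma ramanujan_sum_uminus: "n > 0 \<Longrightarrow> ramanujan_sum n (- x) = ramanujan_sum n x"
  using ramanujan_sum_mult[of n "-1" x] by simp

text \<open>A Bezout relation u b + v a = 1 splits the character modulo \<open>a * b\<close> into
  characters modulo \<open>a\<close> and \<open>b\<close>, with arguments scaled by \<open>u\<close>
  and \<open>v\<close>. These are units and drop out once the sum has been factored.\<close>

lemma ramanujan_sum_coprime_mult:
  assumes pos: "a > 0" "b > 0" and ab: "coprime a b"
  shows "ramanujan_sum (a * b) x = ramanujan_sum a x * ramanujan_sum b x"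
proof -
  have "coprime (int b) (int a)" using ab by (simp add: coprime_commute)
  then obtain u v where uv: "u * int b + v * int a = 1"
    by (metis bezout_int coprime_imp_gcd_eq_1)
  \<comment> \<open>A common divisor of \<open>u\<close> and \<open>a\<close>, or of
    \<open>v\<close> and \<open>b\<close>, divides both terms of the Bezout relation and hence
    1.\<close>
  have u: "coprime u (int a)" and v: "coprime v (int b)"
    by (rule coprimeI, metis uv dvd_add dvd_mult dvd_mult2)+
  have "add_char (a * b) (k * x) = add_char a (k * (u * x)) * add_char b (k * (v * x))" for k
  proof -
    have "k * x = k * x * (u * int b + v * int a)" using uv by simp
    also have "\<dots> = int b * (k * (u * x)) + int a * (k * (v * x))" by (simp add: algebra_simps)
    finally show ?thesis
      using add_char_mult_cancel[OF pos(2), of a] add_char_mult_cancel[OF pos(1), of b]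
      by (metis add_char_add mult.commute)
  qed
  then have "ramanujan_sum (a * b) x = ramanujan_sum a (u * x) * ramanujan_sum b (v * x)"
    unfolding ramanujan_sum_def using assms
    by (simp add: sum_units_mod_crt unit_periodic_add_char)
  then show ?thesis using pos u v by (simp add: ramanujan_sum_mult)
qed

text \<open>A geometric sum whose ratio is an n-th root of unity, equal to 1 exactly when
  \<open>n\<close> divides \<open>x\<close>.\<close>

lemma sum_add_char:
  assumes "n > 0"
  shows "(\<Sum>k\<in>{0..<int n}. add_char n (k * x)) = (if int n dvd x then of_nat n else 0)"
proof -
  have "(\<Sum>k\<in>{0..<int n}. add_char n (k * x)) = (\<Sum>i<n. add_char n (int i * x))"
    using sum.reindex[of int "{0..<n}" "\<lambda>k. add_char n (k * x)"] image_int_atLeastLessThan[of 0 n]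
    by (simp add: lessThan_atLeast0)
  also have "\<dots> = (\<Sum>i<n. add_char n x ^ i)"
    by (simp add: add_char_mult_nat[symmetric] mult.commute)
  also have "\<dots> = (if int n dvd x then of_nat n else 0)"
  proof (cases "int n dvd x")
    case True
    then have "add_char n x = 1" using assms add_char_eq_1_iff by blast
    then show ?thesis using True by simp
  next
    case False
    then have "add_char n x \<noteq> 1" using assms add_char_eq_1_iff by blast
    moreover have "add_char n x ^ n = 1"
      using add_char_eq_1_iff[OF assms, of "x * int n"] by (simp add: add_char_mult_nat)
    ultimately show ?thesis using False by (simp add: sum_gp_strict)
  qed
  finally show ?thesis .
qed

lemma units_mod_prime:
  assumes "prime p"
  shows "units_mod p = {0..<int p} - {0}"
proof -
  have "coprime k (int p)" if "0 < k" "k < int p" for k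
    using that assms by (metis coprime_commute prime_imp_coprime prime_nat_int_transfer zdvd_not_zless)
  moreover have "\<not> coprime 0 (int p)" using assms by auto
  ultimately show ?thesis by (force simp: units_mod_def)
qed

text \<open>Only the residue 0 is missing from the full character sum, and its term is 1.\<close>

lemma ramanujan_sum_prime:
  assumes "prime p"
  shows "ramanujan_sum p x = (if int p dvd x then of_nat p else 0) - 1"
proof -
  have p: "p > 0" using assms prime_gt_0_nat by blast
  have "ramanujan_sum p x = (\<Sum>k\<in>{0..<int p}. add_char p (k * x)) - 1"
    unfolding ramanujan_sum_def units_mod_prime[OF assms] using p
    by (subst sum_diff1) (auto simp: add_char_def)
  then show ?thesis by (simp add: sum_add_char[OF p])
qed

subsection \<open>Divisor counts against Ramanujan sums\<close>

lemma common_divisor_count_cong: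
  assumes "[x = y] (mod int n)"
  shows "common_divisor_count n x = common_divisor_count n y"
proof -
  have "int q dvd x \<longleftrightarrow> int q dvd y" if "q dvd n" for q
    using assms that by (meson cong_dvd_iff cong_modulus_minus_iff cong_dvd_modulus of_nat_dvd_iff)
  then show ?thesis unfolding common_divisor_count_def by (metis (lifting))
qed

text \<open>Every divisor of \<open>p * m\<close> is \<open>q\<close> or \<open>p * q\<close> for a
  divisor \<open>q\<close> of \<open>m\<close>, and by coprimality \<open>p * q\<close> divides
  \<open>x\<close> iff both \<open>p\<close> and \<open>q\<close> do.\<close>

lemma common_divisor_count_prime_mult:
  assumes p: "prime p" and m: "coprime p m" "m > 0"
  shows "common_divisor_count (p * m) x = (if int p dvd x then 2 else 1) * common_divisor_count m x"
proof -
  let ?A = "{q. q dvd m \<and> int q dvd x}"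
  have fin: "finite ?A" using m by auto
  have split: "{q. q dvd p * m \<and> int q dvd x} = ?A \<union> (if int p dvd x then (*) p ` ?A else {})"
  proof (intro Set.set_eqI iffI)
    fix q assume q: "q \<in> {q. q dvd p * m \<and> int q dvd x}"
    show "q \<in> ?A \<union> (if int p dvd x then (*) p ` ?A else {})"
    proof (cases "p dvd q")
      case True
      then obtain r where r: "q = p * r" by auto
      have "r dvd m" using q r p by (auto simp: prime_gt_0_nat)
      moreover have "int p dvd x" "int r dvd x" using q r by (auto dest: dvd_mult_left dvd_mult_right)
      ultimately show ?thesis using r by auto
    next
      case False
      then have "coprime q p" using p by (metis coprime_commute prime_imp_coprime)
      then have "q dvd m" using q by (simp add: coprime_dvd_mult_right_iff)
      then show ?thesis using q by auto
    qed
  next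
    fix q assume q: "q \<in> ?A \<union> (if int p dvd x then (*) p ` ?A else {})"
    then show "q \<in> {q. q dvd p * m \<and> int q dvd x}"
    proof
      assume "q \<in> (if int p dvd x then (*) p ` ?A else {})"
      then obtain r where r: "q = p * r" "r dvd m" "int r dvd x" "int p dvd x"
        by (auto split: if_splits)
      have "coprime (int p) (int r)" using m r by (metis coprime_divisors coprime_int_iff dvd_refl)
      then have "int p * int r dvd x" using r by (simp add: divides_mult)
      then show ?thesis using r by auto
    qed auto
  qed
  have disj: "?A \<inter> (*) p ` ?A = {}"
    using m p by (auto dest!: dvd_mult_left)
  have "card ((*) p ` ?A) = card ?A"
    using p by (intro card_image) (auto simp: inj_on_def prime_gt_0_nat)
  then show ?thesis
    unfolding common_divisor_count_def split using fin disj by (auto simp: card_Un_disjoint)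
qed

lemma common_divisor_count_1 [simp]: "common_divisor_count (Suc 0) x = 1"
  unfolding common_divisor_count_def by (auto simp: card_1_singleton_iff)

text \<open>The sum called F above, with the divisors 1 and 2 included in the weight.\<close>

definition ramanujan_convolution :: "nat \<Rightarrow> int \<Rightarrow> complex" where
  "ramanujan_convolution n j =
     (\<Sum>t\<in>units_mod n. of_nat (common_divisor_count n (t - 1)) * ramanujan_sum n (t - j))"

lemma unit_periodic_convolution:
  assumes "n > 0"
  shows "unit_periodic n (\<lambda>t. of_nat (common_divisor_count n (t - 1)) * ramanujan_sum n (t - j))"
  unfolding unit_periodic_def
proof (intro allI impI)
  fix k k' assume c: "[k = k'] (mod int n)"
  have "common_divisor_count n (k - 1) = common_divisor_count n (k' - 1)"
    "ramanujan_sum n (k - j) = ramanujan_sum n (k' - j)"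
    using assms c by (auto intro!: common_divisor_count_cong ramanujan_sum_cong cong_diff)
  then show "of_nat (common_divisor_count n (k - 1)) * ramanujan_sum n (k - j) =
    of_nat (common_divisor_count n (k' - 1)) * ramanujan_sum n (k' - j)" by simp
qed

text \<open>Modulo a prime the weight is 1 plus the indicator of t = 1, so the convolution is c(1 -
  j) plus the sum of c(t - j) over all units \<open>t\<close>. The latter is p - (p - 1) = 1, which
  cancels the -1 in c(1 - j).\<close>

lemma ramanujan_convolution_prime:
  assumes p: "prime p" and j: "coprime j (int p)"
  shows "ramanujan_convolution p j = (if [j = 1] (mod int p) then of_nat p else 0)"
proof -
  have p0: "p > 0" and p1: "p > 1" using p prime_gt_0_nat prime_gt_1_nat by blast+
  have d: "common_divisor_count p x = (if int p dvd x then 2 else 1)" for x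
    using common_divisor_count_prime_mult[OF p, of 1 x] by simp
  have u: "1 \<in> units_mod p" using p1 by (simp add: units_mod_def)
  have t1: "int p dvd t - 1 \<longleftrightarrow> t = 1" if "t \<in> units_mod p" for t
    using units_mod_cong_imp_eq[OF that u] by (auto simp: cong_iff_dvd_diff)
  define j' where "j' = j mod int p"
  have j': "j' \<in> units_mod p" using p0 j by (simp add: j'_def mod_in_units_mod)
  have tj: "int p dvd t - j \<longleftrightarrow> t = j'" if "t \<in> units_mod p" for t
    using that p1 unfolding j'_def by (auto simp: units_mod_def cong_def mod_eq_dvd_iff[symmetric])
  have "ramanujan_convolution p j =
     (\<Sum>t\<in>units_mod p. (if t = 1 then ramanujan_sum p (1 - j) else 0) + ramanujan_sum p (t - j))"
    unfolding ramanujan_convolution_def by (intro sum.cong refl) (auto simp: d t1)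
  also have "\<dots> = ramanujan_sum p (1 - j) + (\<Sum>t\<in>units_mod p. ramanujan_sum p (t - j))"
    using u by (simp add: sum.distrib)
  also have "(\<Sum>t\<in>units_mod p. ramanujan_sum p (t - j)) = (\<Sum>t\<in>units_mod p. (if t = j' then of_nat p else 0) - 1)"
    by (intro sum.cong refl) (auto simp: ramanujan_sum_prime[OF p] tj)
  also have "\<dots> = of_nat p - of_nat (card (units_mod p))"
    using j' by (simp add: sum_subtractf)
  also have "card (units_mod p) = p - 1"
    using p0 by (simp add: units_mod_prime[OF p])
  also have "of_nat p - of_nat (p - 1) = (1 :: complex)"
    using p0 by (simp add: of_nat_diff)
  finally show ?thesis
    by (auto simp: ramanujan_sum_prime[OF p] cong_iff_dvd_diff dvd_diff_commute)
qed

text \<open>One prime is split off at a time. Squarefreeness makes it coprime to the cofactor, so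
  the weight, the Ramanujan sum, the range of summation and the condition on \<open>j\<close> all
  factor.\<close>

lemma ramanujan_convolution_squarefree:
  assumes "squarefree n" "coprime j (int n)"
  shows "ramanujan_convolution n j = (if [j = 1] (mod int n) then of_nat n else 0)"
  using assms
proof (induction n rule: less_induct)
  case (less n)
  have n0: "n > 0" using less.prems by (metis gr0I not_squarefree_0)
  show ?case
  proof (cases "n = 1")
    case True
    then show ?thesis
      by (simp add: ramanujan_convolution_def ramanujan_sum_def add_char_def)
  next
    case False
    then obtain p m where p: "prime p" and n: "n = p * m" using prime_factor_nat by (metis dvdE)
    have p0: "p > 0" using p prime_gt_0_nat by blast
    have m0: "m > 0" using n n0 by simp
    have cop: "coprime p m"
    proof (rule ccontr)
      assume "\<not> coprime p m"
      then have "p dvd m" using p prime_imp_coprime by blast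
      then have "p\<^sup>2 dvd n" by (simp add: n power2_eq_square)
      then show False using less.prems(1) p by (auto simp: squarefree_def)
    qed
    have sq: "squarefree m" using less.prems n squarefree_mono[of m n] n0 by simp
    have jm: "coprime j (int p)" "coprime j (int m)" using less.prems n by auto
    have "m < n" using n m0 prime_gt_1_nat[OF p] by simp
    then have IH: "ramanujan_convolution m j = (if [j = 1] (mod int m) then of_nat m else 0)"
      using less.IH sq jm by blast
    \<comment> \<open>The factor 2 or 1 split off from the weight is the count for \<open>p\<close>
      itself, by the product formula with cofactor 1.\<close>
    have "ramanujan_convolution n j = ramanujan_convolution p j * ramanujan_convolution m j"
      unfolding ramanujan_convolution_def n
        sum_units_mod_crt[OF p0 m0 cop unit_periodic_convolution[OF p0] unit_periodic_convolution[OF m0], symmetric]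
      by (intro sum.cong refl)
        (simp add: ramanujan_sum_coprime_mult[OF p0 m0 cop] common_divisor_count_prime_mult[OF p cop m0]
          common_divisor_count_prime_mult[OF p, of 1, simplified])
    moreover have "[j = 1] (mod int n) \<longleftrightarrow> [j = 1] (mod int p) \<and> [j = 1] (mod int m)"
      using cop unfolding cong_iff_dvd_diff n of_nat_mult
      by (meson coprime_int_iff divides_mult dvd_mult_left dvd_mult_right)
    ultimately show ?thesis
      using IH ramanujan_convolution_prime[OF p jm(1)] n by simp
  qed
qed


section \<open>Representatives of the units up to sign\<close>

lemma not_cong_uminus:
  assumes "n \<ge> 3" "coprime r (int n)"
  shows "\<not> [r = - r] (mod int n)"
proof
  assume "[r = - r] (mod int n)"
  then have "int n dvd r * 2" by (simp add: cong_iff_dvd_diff mult.commute)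
  then have "int n dvd 2" using assms by (simp add: coprime_commute coprime_dvd_mult_right_iff)
  then show False using assms(1) zdvd_imp_le by force
qed

lemma unit_reps_unique:
  assumes "unit_reps_mod_sign n R" "r \<in> R" "r' \<in> R"
    and "[r = r'] (mod int n) \<or> [r = - r'] (mod int n)"
  shows "r = r'"
  using assms unfolding unit_reps_mod_sign_def by (metis cong_refl)

text \<open>Each class up to sign consists of two units, distinct because n \<ge> 3. Hence the
  residues of \<open>R\<close> and of its negatives partition the units.\<close>

lemma sum_units_mod_reps:
  fixes f :: "int \<Rightarrow> 'a :: comm_monoid_add"
  assumes n: "n \<ge> 3" and R: "unit_reps_mod_sign n R" and fin: "finite R" and f: "unit_periodic n f"
  shows "(\<Sum>k\<in>units_mod n. f k) = (\<Sum>r\<in>R. f r + f (- r))"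
proof -
  let ?P = "\<lambda>r. r mod int n" and ?M = "\<lambda>r. - r mod int n"
  have n0: "n > 0" using n by simp
  have cop: "coprime r (int n)" if "r \<in> R" for r
    using R that by (simp add: unit_reps_mod_sign_def)
  have eq: "r = r'" if "r \<in> R" "r' \<in> R" "[r = r'] (mod int n) \<or> [r = - r'] (mod int n)" for r r'
    using unit_reps_unique[OF R that] .
  have P: "inj_on ?P R" by (rule inj_onI) (simp add: eq cong_def)
  have M: "inj_on ?M R"
  proof (rule inj_onI)
    fix x y assume "x \<in> R" "y \<in> R" "- x mod int n = - y mod int n"
    then show "x = y" using eq[of x y] by (metis cong_def cong_minus_minus_iff)
  qed
  have disj: "?P ` R \<inter> ?M ` R = {}"
  proof (rule ccontr)
    assume "?P ` R \<inter> ?M ` R \<noteq> {}"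
    then obtain r r' where r: "r \<in> R" "r' \<in> R" "[r = - r'] (mod int n)" by (auto simp: cong_def)
    then have "r = r'" using eq by blast
    then show False using r not_cong_uminus[OF n cop] by blast
  qed
  have "units_mod n = ?P ` R \<union> ?M ` R"
  proof (intro Set.set_eqI iffI)
    fix k assume k: "k \<in> units_mod n"
    then obtain r where r: "r \<in> R" "[k = r] (mod int n) \<or> [k = - r] (mod int n)"
      using R units_mod_coprime unfolding unit_reps_mod_sign_def by metis
    have "k = k mod int n" using k by (simp add: units_mod_def)
    then show "k \<in> ?P ` R \<union> ?M ` R" using r by (auto simp: cong_def)
  next
    fix k assume "k \<in> ?P ` R \<union> ?M ` R"
    then show "k \<in> units_mod n" using cop n0 by (auto intro: mod_in_units_mod)
  qed
  then have "(\<Sum>k\<in>units_mod n. f k) = (\<Sum>r\<in>R. f (?P r)) + (\<Sum>r\<in>R. f (?M r))"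
    using fin disj P M by (simp add: sum.union_disjoint sum.reindex)
  also have "\<dots> = (\<Sum>r\<in>R. f r) + (\<Sum>r\<in>R. f (- r))"
    using cop by (simp add: unit_periodic_mod[OF f])
  finally show ?thesis by (simp add: sum.distrib)
qed

section \<open>Convolution of the divisor count with the Ramanujan sum\<close>

lemma div_count_cong:
  assumes "[k = l] (mod int n)"
  shows "div_count n k = div_count n l"
proof -
  have "[k = 1] (mod int q) \<longleftrightarrow> [l = 1] (mod int q)" if "q dvd n" for q
    using assms that by (meson cong_dvd_modulus cong_sym cong_trans of_nat_dvd_iff)
  then show ?thesis unfolding div_count_def by (metis (lifting))
qed

text \<open>If \<open>n\<close> is even, the unit \<open>t\<close> is odd, so 2 divides t - 1. The
  contribution of 1 and 2 is therefore independent of \<open>t\<close>.\<close>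

lemma common_divisor_count_eq_div_count:
  assumes n: "n > 0" and t: "coprime t (int n)"
  shows "common_divisor_count n (t - 1) = div_count n t + card {q \<in> {1, 2}. q dvd n}"
proof -
  have two: "int 2 dvd t - 1" if "2 dvd n"
  proof -
    have "coprime t (int 2)" using t that by (meson coprime_divisors dvd_refl of_nat_dvd_iff)
    then show ?thesis by simp
  qed
  let ?A = "{q. q \<ge> 3 \<and> q dvd n \<and> [t = 1] (mod int q)}" and ?B = "{q \<in> {1, 2}. q dvd n}"
  have "{q. q dvd n \<and> int q dvd t - 1} = ?A \<union> ?B"
  proof (intro Set.set_eqI iffI)
    fix q assume q: "q \<in> {q. q dvd n \<and> int q dvd t - 1}"
    then have "q \<noteq> 0" using n by auto
    then have "q = 1 \<or> q = 2 \<or> q \<ge> 3" by linarith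
    then show "q \<in> ?A \<union> ?B" using q by (auto simp: cong_iff_dvd_diff)
  qed (use two in \<open>auto simp: cong_iff_dvd_diff\<close>)
  moreover have "finite ?A" "finite ?B" using n by auto
  moreover have "?A \<inter> ?B = {}" by auto
  ultimately show ?thesis unfolding common_divisor_count_def div_count_def
    by (simp add: card_Un_disjoint)
qed

lemma unit_periodic_ramanujan_sum: "n > 0 \<Longrightarrow> unit_periodic n (\<lambda>t. ramanujan_sum n (t - w))"
  unfolding unit_periodic_def by (blast intro: ramanujan_sum_cong cong_diff cong_refl)

lemma cong_uminus_one_iff: "[- w = 1] (mod int n) \<longleftrightarrow> [w = - 1] (mod int n)"
  by (metis cong_minus_minus_iff minus_minus)

text \<open>Passing to \<open>common_divisor_count\<close> changes all weights by one constant. Its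
  contribution vanishes, because t -> -t and the evenness of c exchange the sums of c(t - w) and c(t
  + w). What remains is F(w) - F(-w).\<close>

lemma div_count_convolution_squarefree:
  assumes n: "squarefree n" and w: "coprime w (int n)"
  shows "(\<Sum>t\<in>units_mod n. of_nat (div_count n t) * (ramanujan_sum n (t - w) - ramanujan_sum n (t + w))) =
    of_nat n * (of_bool [w = 1] (mod int n) - of_bool [w = - 1] (mod int n))"
proof -
  have n0: "n > 0" using n by (metis gr0I not_squarefree_0)
  define K where "K = card {q \<in> {1, 2}. q dvd n}"
  let ?c = "ramanujan_sum n"
  have dc: "of_nat (div_count n t) = of_nat (common_divisor_count n (t - 1)) - (of_nat K :: complex)"
    if "t \<in> units_mod n" for t
    using common_divisor_count_eq_div_count[OF n0 units_mod_coprime[OF that]] by (simp add: K_def)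
  have "(\<Sum>t\<in>units_mod n. ?c (- t - w)) = (\<Sum>t\<in>units_mod n. ?c (t - w))"
    by (rule sum_units_mod_uminus[OF n0 unit_periodic_ramanujan_sum[OF n0]])
  moreover have "?c (- t - w) = ?c (t + w)" for t
    using ramanujan_sum_uminus[OF n0, of "t + w"] by (simp add: algebra_simps)
  ultimately have sym: "(\<Sum>t\<in>units_mod n. ?c (t + w)) = (\<Sum>t\<in>units_mod n. ?c (t - w))" by simp
  have "(\<Sum>t\<in>units_mod n. of_nat (div_count n t) * (?c (t - w) - ?c (t + w))) =
      (\<Sum>t\<in>units_mod n. (of_nat (common_divisor_count n (t - 1)) * ?c (t - w)
        - of_nat (common_divisor_count n (t - 1)) * ?c (t - (- w))) - of_nat K * (?c (t - w) - ?c (t + w)))"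
    by (intro sum.cong refl) (simp add: dc algebra_simps)
  also have "\<dots> = ramanujan_convolution n w - ramanujan_convolution n (- w)"
    unfolding sum_subtractf sum_distrib_left[symmetric] sym ramanujan_convolution_def by simp
  finally show ?thesis
    using w by (simp add: ramanujan_convolution_squarefree[OF n] cong_uminus_one_iff)
qed

text \<open>Only t = 1 has a nonzero weight, so everything reduces to c(0) = 2 and c(2) = -2. Here
  F(1) = 2 and F(-1) = -2 rather than 4 and 0, but the difference is still 4.\<close>

lemma div_count_convolution_4:
  assumes w: "coprime w (int 4)"
  shows "(\<Sum>t\<in>units_mod 4. of_nat (div_count 4 t) * (ramanujan_sum 4 (t - w) - ramanujan_sum 4 (t + w))) =
    of_nat 4 * (of_bool [w = 1] (mod int 4) - of_bool [w = - 1] (mod int 4))"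
proof -
  have "odd w" using w by (metis coprime_divisors coprime_right_2_iff_odd dvd_refl even_numeral of_nat_numeral)
  then have w13: "w mod 4 = 1 \<or> w mod 4 = 3" by presburger
  have "{0..<4::int} = {0, 1, 2, 3}" by auto
  then have U: "units_mod 4 = {1, 3}"
    unfolding units_mod_def by (auto simp: coprime_iff_gcd_eq_1 gcd_non_0_int)
  have "{q. q dvd (4::nat)} = {1, 2, 4}"
  proof -
    have "q \<in> {1,2,4}" if "q dvd (4::nat)" for q
    proof -
      have "q \<le> 4" "q \<noteq> 0" using that by (auto dest: dvd_imp_le intro!: gr0I)
      then have "q = 1 \<or> q = 2 \<or> q = 3 \<or> q = 4" by linarith
      then show ?thesis using that by auto
    qed
    then show ?thesis by auto
  qed
  then have "{q. 3 \<le> q \<and> q dvd (4::nat) \<and> [1 = 1] (mod int q)} = {4}"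
    "{q. 3 \<le> q \<and> q dvd (4::nat) \<and> [3 = 1] (mod int q)} = {}"
    by (auto simp: cong_def set_eq_iff)
  then have d: "div_count 4 1 = 1" "div_count 4 3 = 0" by (simp_all add: div_count_def)
  \<comment> \<open>This is the term k = 3 of c(2).\<close>
  have "cis (3 * pi) = -1" using cis_mult[of "2 * pi" pi] by simp
  then have c: "ramanujan_sum 4 0 = 2" "ramanujan_sum 4 2 = -2"
    by (simp_all add: ramanujan_sum_def U add_char_def mult.commute)
  have "ramanujan_sum 4 (1 - w) - ramanujan_sum 4 (1 + w) =
    4 * (of_bool [w = 1] (mod int 4) - of_bool [w = - 1] (mod int 4))"
    using w13
  proof
    assume a: "w mod 4 = 1"
    have "[1 - w = 0] (mod int 4)" "[1 + w = 2] (mod int 4)"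
      unfolding cong_def of_nat_numeral using a by presburger+
    then have "ramanujan_sum 4 (1 - w) = 2" "ramanujan_sum 4 (1 + w) = - 2"
      using c ramanujan_sum_cong[of 4] by auto
    then show ?thesis using a by (simp add: cong_def)
  next
    assume a: "w mod 4 = 3"
    have "[1 - w = 2] (mod int 4)" "[1 + w = 0] (mod int 4)"
      unfolding cong_def of_nat_numeral using a by presburger+
    then have "ramanujan_sum 4 (1 - w) = -2" "ramanujan_sum 4 (1 + w) = 2"
      using c ramanujan_sum_cong[of 4] by auto
    then show ?thesis using a by (simp add: cong_def)
  qed
  then show ?thesis by (simp add: U d)
qed

subsection \<open>The sine coefficients\<close>

lemma sine_coeff_eq_Im: "sine_coeff n k = 2 * Im (add_char n k)"
  by (simp add: sine_coeff_def add_char_def)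

lemma sine_coeff_cong: "n > 0 \<Longrightarrow> [k = l] (mod int n) \<Longrightarrow> sine_coeff n k = sine_coeff n l"
  using add_char_cong by (simp add: sine_coeff_eq_Im)

lemma sine_coeff_uminus [simp]: "sine_coeff n (- k) = - sine_coeff n k"
  by (simp add: sine_coeff_def)

text \<open>Product-to-sum formula termwise; summed over the units, the cosines become real parts of
  Ramanujan sums.\<close>

lemma sum_sine_coeff_mult_sine_coeff:
  "(\<Sum>k\<in>units_mod n. sine_coeff n (a * k) * sine_coeff n (b * k)) =
    2 * Re (ramanujan_sum n (a - b) - ramanujan_sum n (a + b))"
proof -
  have "sine_coeff n (a * k) * sine_coeff n (b * k) =
    2 * Re (add_char n (k * (a - b)) - add_char n (k * (a + b)))" for k
  proof -
    have "2 * pi * real_of_int (k * (a - b)) / real n =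
        2 * pi * real_of_int (a * k) / real n - 2 * pi * real_of_int (b * k) / real n"
      "2 * pi * real_of_int (k * (a + b)) / real n =
        2 * pi * real_of_int (a * k) / real n + 2 * pi * real_of_int (b * k) / real n"
      by (simp_all add: algebra_simps diff_divide_distrib add_divide_distrib)
    then show ?thesis unfolding add_char_def sine_coeff_def minus_complex.sel cis.sel
      by (simp only: cos_diff cos_add) (simp add: algebra_simps)
  qed
  then show ?thesis
    by (simp only: ramanujan_sum_def sum_distrib_left[symmetric] sum_subtractf Re_sum[symmetric])
qed

text \<open>The shift by \<open>m\<close> permutes the units of the class and multiplies each term
  by the same factor different from 1, so the sum equals a nontrivial multiple of itself.\<close>

lemma sum_add_char_residue_class:
  assumes p: "prime p" and m: "p dvd m" "m > 0" and n: "n = p * m" and j: "coprime j (int n)"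
  shows "(\<Sum>k\<in>units_mod n. of_bool [k = c] (mod int m) * add_char n (j * k)) = 0"
proof -
  let ?f = "\<lambda>k. of_bool [k = c] (mod int m) * add_char n (j * k)"
  have n0: "n > 0" using m p n by (simp add: prime_gt_0_nat)
  have mn: "int m dvd int n" by (simp add: n)
  have cm: "[k = c] (mod int m) \<longleftrightarrow> [k' = c] (mod int m)" if "[k = k'] (mod int m)" for k k'
    using that by (meson cong_sym cong_trans)
  have f: "unit_periodic n ?f"
    unfolding unit_periodic_def
  proof (intro allI impI)
    fix k k' assume k: "[k = k'] (mod int n)"
    then have "[k = k'] (mod int m)" using mn cong_dvd_modulus by blast
    moreover have "add_char n (j * k) = add_char n (j * k')"
      using k by (intro add_char_cong[OF n0] cong_mult cong_refl)
    ultimately show "?f k = ?f k'" using cm[of k k'] by simp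
  qed
  have shift: "?f (k + int m) = add_char n (j * int m) * ?f k" for k
    using cm[of "k + int m" k] by (simp add: cong_def add_char_add distrib_left)
  have "(\<Sum>k\<in>units_mod n. ?f (k + int m)) = (\<Sum>k\<in>units_mod n. ?f k)"
  proof (rule sum_units_mod_reindex[OF n0 f])
    fix k assume "k \<in> units_mod n"
    then have "coprime k (int n)" by (rule units_mod_coprime)
    then have "coprime k (int m)" by (simp add: n)
    then have km: "coprime (k + int m) (int m)"
      by (simp add: coprime_iff_gcd_eq_1)
    \<comment> \<open>The shifted unit stays coprime to all of \<open>n\<close> because
      \<open>p\<close> divides \<open>m\<close>; this is where the square factor of \<open>n\<close>
      enters.\<close>
    moreover have "coprime (k + int m) (int p)"
      by (rule coprime_divisors[OF dvd_refl _ km]) (use m in simp)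
    ultimately show "coprime (k + int m) (int n)" by (simp add: n)
  qed (simp only: cong_add_rcancel)
  then have "(add_char n (j * int m) - 1) * (\<Sum>k\<in>units_mod n. ?f k) = 0"
    unfolding shift sum_distrib_left[symmetric, of "add_char n (j * int m)"]
    by (simp only: left_diff_distrib mult_1_left diff_self)
  moreover have "add_char n (j * int m) \<noteq> 1"
  proof
    assume "add_char n (j * int m) = 1"
    then have "int n dvd j * int m" using add_char_eq_1_iff[OF n0] by blast
    then have "int p dvd j" using m by (simp add: n)
    moreover have "coprime j (int p)" using j by (simp add: n)
    ultimately have "is_unit (int p)" using coprime_common_divisor[of j "int p" "int p"] by simp
    then show False using p by simp
  qed
  ultimately show ?thesis by simp
qed

text \<open>If p p r = n, then m = p r is at least 2, with equality only for p = 2 and r = 1, that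
  is, n = 4. The bound on \<open>m\<close> keeps 1 and -1 apart modulo \<open>m\<close>.\<close>

lemma not_squarefree_obtain:
  fixes n :: nat
  assumes "n \<ge> 3" "\<not> squarefree n" "n \<noteq> 4"
  obtains p m where "prime p" "n = p * m" "p dvd m" "m \<ge> 3"
proof -
  obtain x where x: "x\<^sup>2 dvd n" "x \<noteq> 1" using assms(2) unfolding squarefree_def by auto
  then obtain p where p: "prime p" "p dvd x" using prime_factor_nat by blast
  then have "p * p dvd n" using x by (metis dvd_trans mult_dvd_mono power2_eq_square)
  then obtain r where r: "n = p * (p * r)" by (metis dvdE mult.assoc)
  have "p * r \<ge> 3"
  proof (rule ccontr)
    assume "\<not> p * r \<ge> 3"
    moreover have "r > 0" "p \<ge> 2" using assms(1) r p prime_ge_2_nat by (auto intro: gr0I)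
    moreover from this have "p \<le> p * r" "r * 2 \<le> p * r" by auto
    ultimately have "p = 2" "r = 1" by linarith+
    then show False using r assms(3) by simp
  qed
  then show ?thesis using that[of p "p * r"] p r by simp
qed

section \<open>Inverses modulo \<open>n\<close> and the entries of the matrices\<close>

context
  fixes n :: nat and R :: "int set" and inv_mod :: "int \<Rightarrow> int"
  assumes n3: "n \<ge> 3" and reps: "unit_reps_mod_sign n R" and fin: "finite R"
    and inv: "\<And>k. coprime k (int n) \<Longrightarrow> [k * inv_mod k = 1] (mod int n)"
begin

lemma n_pos: "n > 0" using n3 by simp

lemma reps_coprime: "r \<in> R \<Longrightarrow> coprime r (int n)"
  using reps by (simp add: unit_reps_mod_sign_def)

lemma inv_mod_coprime:
  assumes "coprime k (int n)"
  shows "coprime (inv_mod k) (int n)"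
  using inv[OF assms] by (metis cong_imp_coprime cong_sym coprime_1_left coprime_mult_left_iff)

text \<open>Cancelling the unit \<open>k\<close> fixes its inverse up to congruence only, so the
  laws for \<open>inv_mod\<close> are congruences, each obtained by exhibiting an inverse.\<close>

lemma inv_mod_unique:
  assumes "coprime k (int n)" "[k * x = 1] (mod int n)"
  shows "[inv_mod k = x] (mod int n)"
proof -
  have "[k * inv_mod k = k * x] (mod int n)" using inv assms by (meson cong_sym cong_trans)
  then show ?thesis using assms(1) by (simp add: cong_mult_lcancel)
qed

lemma inv_mod_cong:
  assumes "coprime k (int n)" "[k = l] (mod int n)"
  shows "[inv_mod k = inv_mod l] (mod int n)"
proof (rule inv_mod_unique[OF assms(1)])
  have "[k * inv_mod l = l * inv_mod l] (mod int n)" using assms by (intro cong_mult cong_refl)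
  also have "[l * inv_mod l = 1] (mod int n)" using inv cong_imp_coprime[OF assms(2,1)] .
  finally show "[k * inv_mod l = 1] (mod int n)" .
qed

lemma inv_mod_uminus:
  assumes "coprime k (int n)"
  shows "[inv_mod (- k) = - inv_mod k] (mod int n)"
  using assms inv by (intro inv_mod_unique) auto

text \<open>Inversion permutes the units: if \<open>k\<close> and \<open>l\<close> have congruent
  inverses, both are inverse to the same unit and hence congruent.\<close>

lemma sum_units_mod_inv:
  fixes f :: "int \<Rightarrow> 'a :: comm_monoid_add"
  assumes "unit_periodic n f"
  shows "(\<Sum>k\<in>units_mod n. f (inv_mod k)) = (\<Sum>k\<in>units_mod n. f k)"
proof (rule sum_units_mod_reindex[OF n_pos assms])
  fix k l assume kl: "k \<in> units_mod n" "l \<in> units_mod n" "[inv_mod k = inv_mod l] (mod int n)"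
  then have c: "coprime k (int n)" "coprime l (int n)" by (auto dest: units_mod_coprime)
  have "[inv_mod k * k = 1] (mod int n)" using inv[OF c(1)] by (simp add: mult.commute)
  moreover have "[inv_mod k * l = 1] (mod int n)"
    using cong_trans[OF cong_mult[OF kl(3) cong_refl[of l]]] inv[OF c(2)] by (simp add: mult.commute)
  ultimately have "[inv_mod k * k = inv_mod k * l] (mod int n)" by (meson cong_sym cong_trans)
  then show "[k = l] (mod int n)" using inv_mod_coprime[OF c(1)] by (simp add: cong_mult_lcancel)
qed (auto intro: inv_mod_coprime units_mod_coprime)

text \<open>The sine is odd, so the difference of counts at \<open>l\<close> is the sum of the terms
  at \<open>l\<close> and \<open>-l\<close>, and the sum over \<open>R\<close> unfolds to all
  units.\<close>

lemma sine_coeff_hat_eq: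
  "sine_coeff_hat n R k = (\<Sum>l\<in>units_mod n. real (div_count n (l * k)) * sine_coeff n l) / real n"
proof -
  have "unit_periodic n (\<lambda>l. real (div_count n (l * k)) * sine_coeff n l)"
    unfolding unit_periodic_def using div_count_cong sine_coeff_cong[OF n_pos] cong_mult[OF _ cong_refl] by metis
  from sum_units_mod_reps[OF n3 reps fin this] show ?thesis
    by (simp add: sine_coeff_hat_def algebra_simps)
qed

lemma sine_coeff_hat_cong:
  assumes "[k = l] (mod int n)"
  shows "sine_coeff_hat n R k = sine_coeff_hat n R l"
  unfolding sine_coeff_hat_eq using assms div_count_cong[OF cong_mult[OF cong_refl]] by metis

lemma sine_coeff_hat_uminus: "sine_coeff_hat n R (- k) = - sine_coeff_hat n R k"
proof -
  have "(\<Sum>l\<in>R. (real (div_count n (l * - k)) - real (div_count n (- l * - k))) * sine_coeff n l) =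
      - (\<Sum>l\<in>R. (real (div_count n (l * k)) - real (div_count n (- l * k))) * sine_coeff n l)"
    unfolding sum_negf[symmetric] by (intro sum.cong refl) (simp add: algebra_simps)
  then show ?thesis unfolding sine_coeff_hat_def by simp
qed

text \<open>The substitution l = t m k* turns l k m* into \<open>t\<close>. It moves
  \<open>k\<close> from the divisor count into the sine, where the sum over \<open>k\<close> can be
  evaluated.\<close>

lemma sine_coeff_hat_shift:
  assumes k: "coprime k (int n)" and m: "coprime m (int n)"
  shows "sine_coeff_hat n R (k * inv_mod m) =
    (\<Sum>t\<in>units_mod n. real (div_count n t) * sine_coeff n (t * m * inv_mod k)) / real n"
proof -
  let ?f = "\<lambda>l. real (div_count n (l * (k * inv_mod m))) * sine_coeff n l"
  have f: "unit_periodic n ?f"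
    unfolding unit_periodic_def using div_count_cong sine_coeff_cong[OF n_pos] cong_mult[OF _ cong_refl] by metis
  have "coprime (m * inv_mod k) (int n)" using m inv_mod_coprime[OF k] by simp
  from sum_units_mod_mult[OF n_pos f this]
  have "(\<Sum>l\<in>units_mod n. ?f l) = (\<Sum>t\<in>units_mod n. ?f (t * (m * inv_mod k)))" by simp
  also have "\<dots> = (\<Sum>t\<in>units_mod n. real (div_count n t) * sine_coeff n (t * m * inv_mod k))"
  proof (intro sum.cong refl)
    fix t
    have "[t * ((k * inv_mod k) * (m * inv_mod m)) = t * (1 * 1)] (mod int n)"
      using inv k m by (intro cong_mult cong_refl) auto
    then have "div_count n (t * (m * inv_mod k) * (k * inv_mod m)) = div_count n t"
      using div_count_cong[of "t * (m * inv_mod k) * (k * inv_mod m)" t n] by (simp add: mult_ac)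
    then show "?f (t * (m * inv_mod k)) = real (div_count n t) * sine_coeff n (t * m * inv_mod k)"
      by (simp add: mult.assoc)
  qed
  finally show ?thesis by (simp add: sine_coeff_hat_eq)
qed

text \<open>Both factors are odd in \<open>k\<close>, so twice the sum over \<open>R\<close> is the
  sum over all units. Exchanging the sums leaves an inner sum of sine products, hence Ramanujan
  sums, and then the convolution identity applies.\<close>

lemma sum_sine_coeff_mult_sine_coeff_hat:
  assumes n: "squarefree n \<or> n = 4" and j: "coprime j (int n)" and m: "coprime m (int n)"
  shows "(\<Sum>k\<in>R. sine_coeff n (j * inv_mod k) * sine_coeff_hat n R (k * inv_mod m)) =
    of_bool [j = m] (mod int n) - of_bool [j = - m] (mod int n)"
proof -
  let ?s = "sine_coeff n" and ?c = "ramanujan_sum n"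
  let ?f = "\<lambda>k. ?s (j * inv_mod k) * sine_coeff_hat n R (k * inv_mod m)"
  define w where "w = j * inv_mod m"
  have w: "coprime w (int n)" using j inv_mod_coprime[OF m] by (simp add: w_def)
  have f: "unit_periodic n ?f"
    unfolding unit_periodic_def
  proof (intro allI impI)
    fix k l assume "coprime k (int n)" and kl: "[k = l] (mod int n)"
    then have "[j * inv_mod k = j * inv_mod l] (mod int n)"
      by (intro cong_mult cong_refl inv_mod_cong)
    moreover have "[k * inv_mod m = l * inv_mod m] (mod int n)" using kl by (intro cong_mult cong_refl)
    ultimately show "?f k = ?f l" using sine_coeff_cong[OF n_pos] sine_coeff_hat_cong by metis
  qed
  have even: "?f (- k) = ?f k" if "k \<in> R" for k
  proof -
    have "[j * inv_mod (- k) = j * - inv_mod k] (mod int n)"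
      using inv_mod_uminus[OF reps_coprime[OF that]] by (intro cong_mult cong_refl)
    then have "?s (j * inv_mod (- k)) = - ?s (j * inv_mod k)"
      using sine_coeff_cong[OF n_pos] by fastforce
    then show ?thesis by (simp add: sine_coeff_hat_uminus)
  qed
  have "2 * (\<Sum>k\<in>R. ?f k) = (\<Sum>k\<in>units_mod n. ?f k)"
    unfolding sum_units_mod_reps[OF n3 reps fin f] sum_distrib_left by (intro sum.cong refl) (subst even, simp_all)
  also have "\<dots> = (\<Sum>k\<in>units_mod n. \<Sum>t\<in>units_mod n.
      real (div_count n t) * (?s (j * inv_mod k) * ?s (t * m * inv_mod k)) / real n)"
    by (intro sum.cong refl)
      (simp add: sine_coeff_hat_shift[OF units_mod_coprime m] sum_distrib_left sum_divide_distrib mult_ac)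
  also have "\<dots> = (\<Sum>t\<in>units_mod n. real (div_count n t) *
      (\<Sum>k\<in>units_mod n. ?s (j * inv_mod k) * ?s (t * m * inv_mod k)) / real n)"
    by (subst sum.swap) (simp add: sum_distrib_left sum_divide_distrib)
  also have "\<dots> = (\<Sum>t\<in>units_mod n. real (div_count n t) * (2 * Re (?c (t - w) - ?c (t + w))) / real n)"
  proof (intro sum.cong refl)
    fix t
    have "unit_periodic n (\<lambda>x. ?s (j * x) * ?s (t * m * x))"
      unfolding unit_periodic_def using sine_coeff_cong[OF n_pos] cong_mult[OF cong_refl] by metis
    from sum_units_mod_inv[OF this]
    have "(\<Sum>k\<in>units_mod n. ?s (j * inv_mod k) * ?s (t * m * inv_mod k)) =
        2 * Re (?c (j - t * m) - ?c (j + t * m))"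
      using sum_sine_coeff_mult_sine_coeff[of n j "t * m"] by simp
    \<comment> \<open>The values 1 and -1 of \<open>e\<close> cover both Ramanujan sums. Inserting
      \<open>m\<close> times its inverse lets the unit \<open>inv_mod m\<close> be pulled out and
      dropped.\<close>
    moreover have *: "[w - e * t = inv_mod m * (j - e * (t * m))] (mod int n)" for e
    proof -
      have "[w - e * t * 1 = w - e * t * (m * inv_mod m)] (mod int n)"
        using inv[OF m] by (intro cong_diff cong_mult cong_refl) (simp add: cong_sym)
      then show ?thesis by (simp add: w_def algebra_simps)
    qed
    have "?c (j - e * (t * m)) = ?c (w - e * t)" for e
      using ramanujan_sum_mult[OF n_pos inv_mod_coprime[OF m]] ramanujan_sum_cong[OF n_pos *[of e]] by simp
    from this[of 1] this[of "-1"] ramanujan_sum_uminus[OF n_pos, of "t - w"]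
    have "?c (j - t * m) = ?c (t - w)" "?c (j + t * m) = ?c (t + w)" by (simp_all add: add.commute)
    ultimately show "real (div_count n t) * (\<Sum>k\<in>units_mod n. ?s (j * inv_mod k) * ?s (t * m * inv_mod k)) / real n =
      real (div_count n t) * (2 * Re (?c (t - w) - ?c (t + w))) / real n" by simp
  qed
  also have "\<dots> = 2 / real n * Re (\<Sum>t\<in>units_mod n. of_nat (div_count n t) * (?c (t - w) - ?c (t + w)))"
    unfolding Re_sum sum_distrib_left by (intro sum.cong refl) simp
  also have "(\<Sum>t\<in>units_mod n. of_nat (div_count n t) * (?c (t - w) - ?c (t + w))) =
      of_nat n * (of_bool [w = 1] (mod int n) - of_bool [w = - 1] (mod int n))"
    using n div_count_convolution_squarefree div_count_convolution_4 w by blast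
  finally have "(\<Sum>k\<in>R. ?f k) = of_bool [w = 1] (mod int n) - of_bool [w = - 1] (mod int n)"
    using n_pos by (simp split: split_of_bool split_of_bool_asm)
  moreover have "[w = e] (mod int n) \<longleftrightarrow> [j = e * m] (mod int n)" for e
  proof -
    have "[w = e] (mod int n) \<longleftrightarrow> [w * m = e * m] (mod int n)" using m by (simp add: cong_mult_rcancel)
    moreover have "[w * m = j * 1] (mod int n)"
      unfolding w_def mult.assoc using inv[OF m] by (intro cong_mult cong_refl) (simp add: mult.commute)
    ultimately show ?thesis by (metis cong_sym cong_trans mult.right_neutral)
  qed
  ultimately show ?thesis by simp
qed

text \<open>The function \<open>y\<close> is the difference of the indicators of 1 and -1 modulo
  \<open>m\<close>, and the vector is \<open>y\<close> at the inverse of \<open>k\<close>, as in the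
  matrix. Oddness of \<open>y\<close> makes the summand even, so the sum over \<open>R\<close> is
  half a sum over all units, which is built from vanishing character sums.\<close>

lemma sine_kernel_vector:
  assumes n: "\<not> squarefree n" "n \<noteq> 4"
  obtains x :: "int \<Rightarrow> real" where
    "\<And>j. j \<in> R \<Longrightarrow> (\<Sum>k\<in>R. sine_coeff n (j * inv_mod k) * x k) = 0" "\<exists>r\<in>R. x r \<noteq> 0"
proof -
  obtain p m where pm: "prime p" "n = p * m" "p dvd m" "m \<ge> 3"
    using not_squarefree_obtain[OF n3 n] .
  let ?s = "sine_coeff n"
  define y :: "int \<Rightarrow> real" where "y k = of_bool [k = 1] (mod int m) - of_bool [k = - 1] (mod int m)" for k
  have y_cong: "y k = y l" if "[k = l] (mod int n)" for k l
  proof -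
    have "[k = l] (mod int m)" using that pm(2) by (metis cong_dvd_modulus dvd_triv_right of_nat_dvd_iff)
    then have "[k = c] (mod int m) \<longleftrightarrow> [l = c] (mod int m)" for c by (meson cong_sym cong_trans)
    then show ?thesis by (simp add: y_def)
  qed
  have y_odd: "y (- k) = - y k" for k
    unfolding y_def cong_uminus_one_iff cong_minus_minus_iff by simp
  have "(\<Sum>k\<in>R. ?s (j * inv_mod k) * y (inv_mod k)) = 0" if "j \<in> R" for j
  proof -
    let ?f = "\<lambda>k. ?s (j * k) * y k"
    have f: "unit_periodic n ?f"
      unfolding unit_periodic_def using sine_coeff_cong[OF n_pos] cong_mult[OF cong_refl] y_cong by metis
    have g: "unit_periodic n (\<lambda>k. ?f (inv_mod k))"
      using f inv_mod_cong inv_mod_coprime unfolding unit_periodic_def by metis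
    have even: "?f (inv_mod (- k)) = ?f (inv_mod k)" if "k \<in> R" for k
    proof -
      have "?f (inv_mod (- k)) = ?f (- inv_mod k)"
        using unit_periodicD[OF f _ inv_mod_uminus] inv_mod_coprime reps_coprime[OF that] by simp
      then show ?thesis by (simp add: y_odd)
    qed
    have "2 * (\<Sum>k\<in>R. ?f (inv_mod k)) = (\<Sum>k\<in>units_mod n. ?f (inv_mod k))"
      unfolding sum_units_mod_reps[OF n3 reps fin g] sum_distrib_left by (intro sum.cong refl) (subst even, simp_all)
    also have "\<dots> = (\<Sum>k\<in>units_mod n. ?f k)" by (rule sum_units_mod_inv[OF f])
    also have "\<dots> = 2 * Im ((\<Sum>k\<in>units_mod n. of_bool [k = 1] (mod int m) * add_char n (j * k)) -
        (\<Sum>k\<in>units_mod n. of_bool [k = - 1] (mod int m) * add_char n (j * k)))"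
      unfolding sum_subtractf[symmetric] Im_sum sum_distrib_left
      by (intro sum.cong refl) (simp add: sine_coeff_eq_Im y_def)
    also have "\<dots> = 0"
      using sum_add_char_residue_class[OF pm(1,3) _ pm(2) reps_coprime[OF that]] pm(4) by simp
    finally show ?thesis by simp
  qed
  moreover have "\<exists>r\<in>R. y (inv_mod r) \<noteq> 0"
  proof -
    \<comment> \<open>The representative of the class of 1 gives a nonzero entry: its inverse is 1
      or -1 modulo \<open>n\<close>, where \<open>y\<close> is 1 or -1.\<close>
    obtain r where r: "r \<in> R" "[1 = r] (mod int n) \<or> [1 = - r] (mod int n)"
      using reps unfolding unit_reps_mod_sign_def by (metis coprime_1_left)
    have "\<not> [1 = - 1] (mod int m)" using not_cong_uminus[OF pm(4), of 1] by simp
    then have y1: "y 1 = 1" by (simp add: y_def)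
    have i1: "[inv_mod 1 = 1] (mod int n)" by (rule inv_mod_unique) auto
    have "y (inv_mod r) \<noteq> 0"
      using r(2)
    proof
      assume "[1 = r] (mod int n)"
      then have "[inv_mod 1 = inv_mod r] (mod int n)" by (intro inv_mod_cong) auto
      then have "y (inv_mod r) = y 1" using y_cong i1 by metis
      then show ?thesis using y1 by simp
    next
      assume "[1 = - r] (mod int n)"
      then have "[inv_mod 1 = inv_mod (- r)] (mod int n)" by (intro inv_mod_cong) auto
      then have "y 1 = y (- inv_mod r)"
        using y_cong i1 inv_mod_uminus[OF reps_coprime[OF r(1)]] by metis
      then show ?thesis using y1 by (simp add: y_odd)
    qed
    then show ?thesis using r(1) by blast
  qed
  ultimately show ?thesis using that[of "\<lambda>k. y (inv_mod k)"] by blast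
qed

end

section \<open>From sums over representatives to matrices\<close>

lemma sum_nth_distinct:
  assumes "distinct xs"
  shows "(\<Sum>i\<in>{0..<length xs}. f (xs ! i)) = sum f (set xs)"
  using sum.reindex_bij_betw[OF bij_betw_nth[OF assms, of "{0..<length xs}" "set xs"], of f]
  by (simp add: lessThan_atLeast0)

theorem theorem1:
  fixes n :: nat and R :: "int set" and rs :: "int list" and inv_mod :: "int \<Rightarrow> int"
  assumes "n \<ge> 3"
    and "unit_reps_mod_sign n R"
    and "distinct rs" and "set rs = R"
    and "\<And>k. coprime k (int n) \<Longrightarrow> [k * inv_mod k = 1] (mod int n)"
  shows "(invertible_mat (sine_matrix n inv_mod rs) \<longleftrightarrow> squarefree n \<or> n = 4) \<and>
    (squarefree n \<or> n = 4 \<longrightarrow>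
       inverts_mat (sine_matrix n inv_mod rs) (sine_matrix_hat n inv_mod rs) \<and>
       inverts_mat (sine_matrix_hat n inv_mod rs) (sine_matrix n inv_mod rs))"
proof -
  define N where "N = length rs"
  define A where "A = sine_matrix n inv_mod rs"
  define B where "B = sine_matrix_hat n inv_mod rs"
  have fin: "finite R" using assms(4) by auto
  note ctx = assms(1,2) fin assms(5)
  have A: "A \<in> carrier_mat N N" and B: "B \<in> carrier_mat N N"
    by (simp_all add: A_def B_def N_def sine_matrix_def sine_matrix_hat_def quotient_matrix_def)
  have A_nth: "A $$ (i, k) = sine_coeff n (rs ! i * inv_mod (rs ! k))"
    and B_nth: "B $$ (i, k) = sine_coeff_hat n R (rs ! i * inv_mod (rs ! k))" if "i < N" "k < N" for i k
    using that assms(4)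
    by (simp_all add: A_def B_def N_def sine_matrix_def sine_matrix_hat_def quotient_matrix_def)
  have rs: "rs ! i \<in> R" "coprime (rs ! i) (int n)" if "i < N" for i
    using that assms(2,4) nth_mem by (auto simp: N_def unit_reps_mod_sign_def)
  have inverse: "inverts_mat A B \<and> inverts_mat B A" if n: "squarefree n \<or> n = 4"
  proof -
    have "A * B = 1\<^sub>m N"
    proof (rule eq_matI)
      fix i l assume "i < dim_row (1\<^sub>m N)" "l < dim_col (1\<^sub>m N)"
      then have il: "i < N" "l < N" by auto
      have "(A * B) $$ (i, l) = (\<Sum>k\<in>{0..<N}. A $$ (i, k) * B $$ (k, l))"
        using A B il by (simp add: scalar_prod_def)
      also have "\<dots> = (\<Sum>k\<in>R. sine_coeff n (rs ! i * inv_mod k) * sine_coeff_hat n R (k * inv_mod (rs ! l)))"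
        using il sum_nth_distinct[OF assms(3)] by (simp add: A_nth B_nth N_def assms(4))
      also have "\<dots> = of_bool [rs ! i = rs ! l] (mod int n) - of_bool [rs ! i = - rs ! l] (mod int n)"
        by (rule sum_sine_coeff_mult_sine_coeff_hat[OF ctx n rs(2)[OF il(1)] rs(2)[OF il(2)]])
      \<comment> \<open>Representatives congruent up to sign are equal, and none is congruent to its
        own negative, so the second indicator is always 0.\<close>
      also have "\<dots> = of_bool (i = l)"
      proof (cases "i = l")
        case True
        then show ?thesis using not_cong_uminus[OF assms(1) rs(2)[OF il(2)]] by simp
      next
        case False
        then have "rs ! i \<noteq> rs ! l" using il assms(3) by (simp add: N_def nth_eq_iff_index_eq)
        then show ?thesis using False unit_reps_unique[OF assms(2) rs(1)[OF il(1)] rs(1)[OF il(2)]] by auto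
      qed
      finally show "(A * B) $$ (i, l) = 1\<^sub>m N $$ (i, l)" using il by simp
    qed (use A B in auto)
    \<comment> \<open>For square matrices over a field a right inverse is also a left
      inverse.\<close>
    moreover from this have "B * A = 1\<^sub>m N" by (rule mat_mult_left_right_inverse[OF A B])
    ultimately show ?thesis using A B by (simp add: inverts_mat_def)
  qed
  moreover have "squarefree n \<or> n = 4" if inv: "invertible_mat A"
  proof (rule ccontr)
    assume "\<not> (squarefree n \<or> n = 4)"
    then obtain x where x: "\<And>j. j \<in> R \<Longrightarrow> (\<Sum>k\<in>R. sine_coeff n (j * inv_mod k) * x k) = 0" "\<exists>r\<in>R. x r \<noteq> 0"
      using sine_kernel_vector[OF ctx] by blast
    obtain C where C: "A * C = 1\<^sub>m N" "C * A = 1\<^sub>m (dim_row C)"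
      using inv A by (auto simp: invertible_mat_def inverts_mat_def)
    \<comment> \<open>Invertibility does not prescribe the shape of \<open>C\<close>; it is read off
      from the two products.\<close>
    have "dim_row C = N" "dim_col C = N"
      using C A by (metis carrier_matD(2) index_mult_mat(3) index_one_mat(3))+
    then have C_carrier: "C \<in> carrier_mat N N" by auto
    define v where "v = vec N (\<lambda>i. x (rs ! i))"
    have v: "v \<in> carrier_vec N" by (simp add: v_def)
    have "A *\<^sub>v v = 0\<^sub>v N"
    proof (rule eq_vecI)
      fix i assume "i < dim_vec (0\<^sub>v N)"
      then have i: "i < N" by simp
      have "vec_index (A *\<^sub>v v) i = (\<Sum>k\<in>{0..<N}. A $$ (i, k) * x (rs ! k))"
        using A i by (simp add: scalar_prod_def v_def)
      also have "\<dots> = (\<Sum>k\<in>R. sine_coeff n (rs ! i * inv_mod k) * x k)"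
        using i sum_nth_distinct[OF assms(3)] by (simp add: A_nth N_def assms(4))
      finally show "vec_index (A *\<^sub>v v) i = vec_index (0\<^sub>v N) i" using x(1) rs(1)[OF i] i by simp
    qed (use A in auto)
    \<comment> \<open>Applying the left inverse to \<open>A *\<^sub>v v\<close> forces
      \<open>v\<close> to vanish, against the choice of \<open>x\<close>.\<close>
    then have "(C * A) *\<^sub>v v = 0\<^sub>v N" using A C_carrier v
      by (simp add: assoc_mult_mat_vec[of C N N A N v]) (auto intro!: eq_vecI simp: scalar_prod_def)
    then have "v = 0\<^sub>v N" using C C_carrier v by simp
    then have "x (rs ! i) = 0" if "i < N" for i using that by (metis index_vec index_zero_vec(1) v_def)
    then show False using x(2) assms(4) by (metis N_def in_set_conv_nth)
  qed
  moreover have "invertible_mat A" if "squarefree n \<or> n = 4"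
    using inverse[OF that] A by (auto simp: invertible_mat_def)
  ultimately show ?thesis unfolding A_def B_def by blast
qed

end
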